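(* Let $E$ be a normed space, let $f\colon E\to E$, let $p,q\in[1,+\infty)$ and let $\alpha\in(0,1]\cap(0,\frac pq)$. Assume that the composition operator $C_f$ maps $l^p(E)$ into $bv_q(E)$. Then $C_f\colon l^p(E)\to bv_q(E)$ is Hölder continuous with exponent $\alpha$ if and only if the map $f$ is constant.
   Context: $E$ is a normed space over $\mathbb R$ or $\mathbb C$ with norm $\|\cdot\|$. For a map $f\colon E\to E$, the composition operator $C_f$ assigns to a sequence $x\colon\mathbb N\to E$ the sequence $C_f(x)$ with $C_f(x)(n)=f(x(n))$ for all $n\in\mathbb N$. $l^p(E)$ is the space of sequences $x\colon\mathbb N\to E$ with $\|x\|_{l^p}=\bigl(\sum_{n=1}^\infty\|x(n)\|^p\bigr)^{1/p}<+\infty$. $bv_q(E)$ is the space of all sequences $x\colon\mathbb N\to E$ with $\sum_{n=1}^\infty\|x(n+1)-x(n)\|^q<+\infty$, with norm $\|x\|_{bv_q}=\|x(1)\|+\bigl(\sum_{n=1}^\infty\|x(n+1)-x(n)\|^q\bigr)^{1/q}$. A map $F\colon X\to Y$ between normed spaces is Hölder continuous with exponent $\alpha\in(0,1]$ if there exists $L\ge0$ such that $\|F(x)-F(y)\|_Y\le L\|x-y\|_X^\alpha$ for all $x,y\in X$. *)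

theory Defs
  imports "HOL-Analysis.Analysis"
begin

text \<open>
  Sequences are functions on \<^typ>\<open>nat\<close>, so the first term of a sequence, usually written
  $x(1)$, is \<open>x 0\<close>.
  The class \<open>real_normed_vector\<close> also covers complex normed spaces: they are real normed spaces by
  restriction of scalars, and no notion below involves the scalar field beyond that.
\<close>

definition lp_space :: "real \<Rightarrow> (nat \<Rightarrow> 'a::real_normed_vector) set" where
  "lp_space p = {x. summable (\<lambda>n. norm (x n) powr p)}"

definition lp_norm :: "real \<Rightarrow> (nat \<Rightarrow> 'a::real_normed_vector) \<Rightarrow> real" where
  "lp_norm p x = (\<Sum>n. norm (x n) powr p) powr (1 / p)"

definition bv_space :: "real \<Rightarrow> (nat \<Rightarrow> 'a::real_normed_vector) set" where
  "bv_space q = {x. summable (\<lambda>n. norm (x (Suc n) - x n) powr q)}"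

definition bv_norm :: "real \<Rightarrow> (nat \<Rightarrow> 'a::real_normed_vector) \<Rightarrow> real" where
  "bv_norm q x = norm (x 0) + (\<Sum>n. norm (x (Suc n) - x n) powr q) powr (1 / q)"

definition comp_op :: "('a \<Rightarrow> 'b) \<Rightarrow> (nat \<Rightarrow> 'a) \<Rightarrow> nat \<Rightarrow> 'b" where
  "comp_op f x = (\<lambda>n. f (x n))"

text \<open>
  Normed spaces are given here by a carrier inside an ambient type together with a norm function, since
  the norms on sequences depend on a real parameter. Subtraction of sequences is pointwise. As
  \<open>0 powr \<alpha> = 0\<close>, the bound is the intended one also for \<open>x = y\<close>.
\<close>

definition Holder_continuous ::
  "'u::minus set \<Rightarrow> ('u \<Rightarrow> real) \<Rightarrow> 'v::minus set \<Rightarrow> ('v \<Rightarrow> real) \<Rightarrow> real \<Rightarrow> ('u \<Rightarrow> 'v) \<Rightarrow> bool" where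
  "Holder_continuous X normX Y normY \<alpha> F \<longleftrightarrow>
     F \<in> X \<rightarrow> Y \<and>
     (\<exists>L\<ge>0. \<forall>x\<in>X. \<forall>y\<in>X. normY (F x - F y) \<le> L * normX (x - y) powr \<alpha>)"

end

theory Submission
  imports Defs "HOL-Real_Asymp.Real_Asymp"
begin

text \<open>
  For points \<open>u\<close>, \<open>v\<close> let \<open>x = (0, u, 0, u, \<dots>, 0, u, 0, 0, \<dots>)\<close> with \<open>N\<close> entries \<open>u\<close>, and let
  \<open>y\<close> be the same sequence built from \<open>v\<close>. Then \<open>f \<circ> x - f \<circ> y\<close> oscillates \<open>2 * N\<close> times between
  \<open>0\<close> and \<open>f u - f v\<close>, so its \<open>bv\<close> norm is of order \<open>N powr (1 / q)\<close>, while the \<open>l\<^sup>p\<close> norm of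
  \<open>x - y\<close> is of order \<open>N powr (1 / p)\<close>. Since \<open>\<alpha> / p < 1 / q\<close>, letting \<open>N\<close> grow forces \<open>f u = f v\<close>.
\<close>

definition spikes :: "nat \<Rightarrow> 'a \<Rightarrow> nat \<Rightarrow> 'a::real_normed_vector" where
  "spikes N u = (\<lambda>n. if odd n \<and> n < 2 * N then u else 0)"

lemma spikes_diff: "spikes N u - spikes N v = spikes N (u - v)"
  by (auto simp: spikes_def fun_eq_iff)

text \<open>Off the spikes both composed sequences take the value \<open>f 0\<close>, which
  cancels.\<close>

lemma comp_op_spikes_diff:
  "comp_op f (spikes N u) - comp_op f (spikes N v) = spikes N (f u - f v)"
  by (auto simp: spikes_def comp_op_def fun_eq_iff)

lemma spikes_in_lp_space: "spikes N u \<in> lp_space p"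
proof -
  have "summable (\<lambda>n. norm (spikes N u n) powr p)"
    by (rule summable_finite[of "{..<2 * N}"]) (auto simp: spikes_def)
  then show ?thesis
    by (simp add: lp_space_def)
qed

text \<open>Counting all \<open>2 * N\<close> indices instead of the \<open>N\<close> odd ones costs
  only a constant factor and gives the same base as in \<open>bv_norm_spikes\<close>.\<close>

lemma lp_norm_spikes_le:
  assumes "p > 0"
  shows "lp_norm p (spikes N u) \<le> real (2 * N) powr (1 / p) * norm u"
proof -
  have "(\<Sum>n. norm (spikes N u n) powr p) = (\<Sum>n<2 * N. norm (spikes N u n) powr p)"
    by (rule suminf_finite) (auto simp: spikes_def)
  also have "\<dots> \<le> (\<Sum>n<2 * N. norm u powr p)"
    by (rule sum_mono) (auto simp: spikes_def)
  finally have "(\<Sum>n. norm (spikes N u n) powr p) \<le> real (2 * N) * norm u powr p"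
    by simp
  moreover have "0 \<le> (\<Sum>n. norm (spikes N u n) powr p)"
    using spikes_in_lp_space[of N u p] by (auto simp: lp_space_def intro!: suminf_nonneg)
  ultimately have "lp_norm p (spikes N u) \<le> (real (2 * N) * norm u powr p) powr (1 / p)"
    unfolding lp_norm_def using assms by (intro powr_mono2) auto
  also have "\<dots> = real (2 * N) powr (1 / p) * norm u"
    using assms by (simp add: powr_mult powr_powr)
  finally show ?thesis .
qed

text \<open>Each spike is entered and left once, the last one by the step from
  \<open>2 * N - 1\<close> to \<open>2 * N\<close>. Index 0 is even, so the initial term adds
  nothing.\<close>

lemma bv_norm_spikes:
  assumes "q > 0"
  shows "bv_norm q (spikes N d) = real (2 * N) powr (1 / q) * norm d"
proof -
  have "norm (spikes N d (Suc n) - spikes N d n) = norm d" if "n < 2 * N" for n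
    \<comment> \<open>If \<open>n\<close> is even, then \<open>n < 2 * N\<close> also gives
      \<open>Suc n < 2 * N\<close>, so \<open>Suc n\<close> carries a spike.\<close>
    using that by (cases "even n") (auto simp: spikes_def elim!: evenE)
  moreover have "(\<Sum>n. norm (spikes N d (Suc n) - spikes N d n) powr q)
      = (\<Sum>n<2 * N. norm (spikes N d (Suc n) - spikes N d n) powr q)"
    by (rule suminf_finite) (use assms in \<open>auto simp: spikes_def\<close>)
  ultimately have "(\<Sum>n. norm (spikes N d (Suc n) - spikes N d n) powr q) = real (2 * N) * norm d powr q"
    by simp
  moreover have "spikes N d 0 = 0"
    by (simp add: spikes_def)
  ultimately show ?thesis
    using assms by (simp add: bv_norm_def powr_mult powr_powr)
qed

lemma Holder_comp_op_constant:
  fixes f :: "'a::real_normed_vector \<Rightarrow> 'b::real_normed_vector"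
  assumes "p > 0" "q > 0" "0 < \<alpha>" "\<alpha> < p / q"
    and "Holder_continuous (lp_space p) (lp_norm p) (bv_space q) (bv_norm q) \<alpha> (comp_op f)"
  shows "f u = f v"
proof (rule ccontr)
  assume "f u \<noteq> f v"
  then have d: "norm (f u - f v) > 0"
    by simp
  obtain L where "L \<ge> 0" and L: "\<And>x y. x \<in> lp_space p \<Longrightarrow> y \<in> lp_space p \<Longrightarrow>
      bv_norm q (comp_op f x - comp_op f y) \<le> L * lp_norm p (x - y) powr \<alpha>"
    using assms(5) unfolding Holder_continuous_def by blast
  \<comment> \<open>The gap between the growth exponents of the two sides of the Hoelder estimate;
    it is positive because \<alpha> < p / q. \<open>B\<close> collects the factors independent of
    \<open>N\<close>.\<close>
  define \<epsilon> where "\<epsilon> = 1 / q - \<alpha> / p"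
  define B where "B = L * norm (u - v) powr \<alpha> / norm (f u - f v)"
  have "\<epsilon> > 0"
    using assms(1-4) by (simp add: \<epsilon>_def field_simps)
  have bound: "real (2 * N) powr \<epsilon> \<le> B" if "N > 0" for N
  proof -
    let ?M = "real (2 * N)"
    have "?M powr (1 / q) * norm (f u - f v) \<le> L * lp_norm p (spikes N (u - v)) powr \<alpha>"
      using L[OF spikes_in_lp_space spikes_in_lp_space, of N u N v] \<open>q > 0\<close>
      by (simp add: spikes_diff comp_op_spikes_diff bv_norm_spikes)
    also have "\<dots> \<le> L * (?M powr (1 / p) * norm (u - v)) powr \<alpha>"
      using \<open>L \<ge> 0\<close> \<open>\<alpha> > 0\<close> lp_norm_spikes_le[OF \<open>p > 0\<close>]
      by (intro mult_left_mono powr_mono2) (auto simp: lp_norm_def)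
    also have "\<dots> = ?M powr (\<alpha> / p) * (L * norm (u - v) powr \<alpha>)"
      by (simp add: powr_mult powr_powr)
    \<comment> \<open>Divide by \<open>?M powr (\<alpha> / p)\<close>, which is positive as
      \<open>N > 0\<close>, and by \<open>norm (f u - f v)\<close>.\<close>
    finally show ?thesis
      using d that by (simp add: \<epsilon>_def B_def powr_diff field_simps)
  qed
  have "filterlim (\<lambda>N. real (2 * N) powr \<epsilon>) at_top sequentially"
    using \<open>\<epsilon> > 0\<close> by real_asymp
  then have "eventually (\<lambda>N. real (2 * N) powr \<epsilon> > B \<and> N > 0) sequentially"
    by (intro eventually_conj eventually_gt_at_top) (simp add: filterlim_at_top_dense)
  then obtain N where "real (2 * N) powr \<epsilon> > B" "N > 0"
    by (auto simp: eventually_sequentially)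
  with bound[of N] show False
    by simp
qed

theorem theorem38:
  fixes f :: "'a::real_normed_vector \<Rightarrow> 'a" and p q \<alpha> :: real
  assumes "p \<in> {1..}" and "q \<in> {1..}"
    and "\<alpha> \<in> {0<..1} \<inter> {0<..<p / q}"
    and "comp_op f \<in> lp_space p \<rightarrow> bv_space q"
  shows "Holder_continuous (lp_space p) (lp_norm p) (bv_space q) (bv_norm q) \<alpha> (comp_op f)
    \<longleftrightarrow> f constant_on UNIV"
proof
  assume "Holder_continuous (lp_space p) (lp_norm p) (bv_space q) (bv_norm q) \<alpha> (comp_op f)"
  then have "f u = f 0" for u
    using assms(1-3) by (intro Holder_comp_op_constant[of p q \<alpha>]) auto
  then show "f constant_on UNIV"
    by (auto simp: constant_on_def)
next
  assume "f constant_on UNIV"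
  then obtain c where "\<And>x. f x = c"
    by (auto simp: constant_on_def)
  then have "bv_norm q (comp_op f x - comp_op f y) = 0" for x y
    by (simp add: bv_norm_def comp_op_def)
  \<comment> \<open>The left side of the estimate vanishes, so \<open>L = 0\<close> serves.\<close>
  then show "Holder_continuous (lp_space p) (lp_norm p) (bv_space q) (bv_norm q) \<alpha> (comp_op f)"
    using assms(4) unfolding Holder_continuous_def by (auto intro!: exI[of _ 0])
qed

end
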